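(* Let $a$ be a positive integer. For all positive integers $k,n$, let $G_n(k)$ be the $n\times n$ tridiagonal matrix \[G_n(k)=\begin{bmatrix} ak+2a & ak & 0 & \cdots & 0 & 0\\ -1 & 2 & k & \cdots & 0 & 0\\ 0 & -1 & 2 & \cdots & 0 & 0\\ \vdots & \vdots & \vdots & \ddots & \vdots & \vdots\\ 0 & 0 & 0 & \cdots & 2 & k\\ 0 & 0 & 0 & \cdots & -1 & 2 \end{bmatrix}_{n\times n},\] i.e. the $(1,1)$ entry is $ak+2a$, the $(1,2)$ entry is $ak$, all other diagonal entries are $2$, all other superdiagonal entries are $k$, all subdiagonal entries are $-1$, and all remaining entries are $0$ (so $G_1(k)=[ak+2a]$). Then $\det G_n(k)=G_{k,n+1}$ for all positive integers $k,n$, where $(G_{k,n})_{n\ge0}$ is the Generalized $k$-Pell sequence with $G_{k,0}=G_{k,1}=a$.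
   Context: For positive integers $k,a$, the Generalized $k$-Pell sequence $(G_{k,n})_{n\ge 0}$ is the integer sequence defined by $G_{k,0}=G_{k,1}=a$ and $G_{k,n}=2G_{k,n-1}+kG_{k,n-2}$ for $n\ge 2$. *)

theory Defs
  imports "Jordan_Normal_Form.Determinant"
begin

fun gen_pell :: "int \<Rightarrow> int \<Rightarrow> nat \<Rightarrow> int" where
  "gen_pell a k 0 = a"
| "gen_pell a k (Suc 0) = a"
| "gen_pell a k (Suc (Suc n)) = 2 * gen_pell a k (Suc n) + k * gen_pell a k n"

(* Rows and columns are indexed from 0, so (0, 0) and (0, 1) are the exceptional
   top-left entries, in the usual numbering (1, 1) and (1, 2). *)
definition pell_mat :: "int \<Rightarrow> int \<Rightarrow> nat \<Rightarrow> int mat" where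
  "pell_mat a k n = mat n n (\<lambda>(i, j).
     if i = 0 \<and> j = 0 then a * k + 2 * a
     else if i = 0 \<and> j = 1 then a * k
     else if i = j then 2
     else if j = i + 1 then k
     else if i = j + 1 then - 1
     else 0)"

end

theory Submission
  imports Defs
begin

text \<open>
  The leading principal minors of any tridiagonal matrix, with diagonal \<open>d\<close>, superdiagonal \<open>u\<close> and
  subdiagonal \<open>l\<close>, form a \<^emph>\<open>continuant\<close>: the determinant \<open>D n\<close> of size \<open>n\<close> satisfies
  \<open>D (n + 2) = d (n + 1) * D (n + 1) - l n * u n * D n\<close>.
  Here \<open>d = 2\<close>, \<open>u = k\<close> and \<open>l = -1\<close> away from the corner, so this is exactly the Pell
  recurrence \<open>D (n + 2) = 2 * D (n + 1) + k * D n\<close>. The exceptional first row only affects the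
  initial values: it is chosen so that \<open>D 1\<close> and \<open>D 2\<close> are the Pell numbers with indices 2 and 3.
\<close>

definition tridiag_mat ::
  "(nat \<Rightarrow> 'a) \<Rightarrow> (nat \<Rightarrow> 'a) \<Rightarrow> (nat \<Rightarrow> 'a) \<Rightarrow> nat \<Rightarrow> 'a :: comm_ring_1 mat" where
  "tridiag_mat d u l n = mat n n (\<lambda>(i, j).
     if i = j then d i
     else if j = i + 1 then u i
     else if i = j + 1 then l j
     else 0)"

text \<open>
  The last row has only the two entries \<open>l n\<close> and \<open>d (n + 1)\<close>. Deleting the row and column of
  \<open>d (n + 1)\<close> leaves the next smaller tridiagonal matrix. In the minor belonging to \<open>l n\<close>, the
  last column is zero except for \<open>u n\<close> at the bottom, so a second expansion reduces it to
  \<open>u n\<close> times the determinant of size \<open>n\<close>.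
\<close>

lemma det_tridiag_mat_Suc_Suc:
  "det (tridiag_mat d u l (Suc (Suc n))) =
     d (Suc n) * det (tridiag_mat d u l (Suc n)) - l n * u n * det (tridiag_mat d u l n)"
proof -
  let ?T = "tridiag_mat d u l"
  let ?A = "?T (Suc (Suc n))"
  let ?M = "mat_delete ?A (Suc n) n"
  have A: "?A \<in> carrier_mat (Suc (Suc n)) (Suc (Suc n))"
    by (simp add: tridiag_mat_def)
  have M: "?M \<in> carrier_mat (Suc n) (Suc n)"
    using mat_delete_carrier[OF A] by simp
  have corner: "mat_delete ?A (Suc n) (Suc n) = ?T (Suc n)"
    by (rule eq_matI) (auto simp: mat_delete_def tridiag_mat_def)
  have minor: "mat_delete ?M n n = ?T n"
    by (rule eq_matI) (auto simp: mat_delete_def tridiag_mat_def)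
  have M_entry: "?M $$ (i, n) = (if i = n then u n else 0)" if "i < Suc n" for i
    using that by (auto simp: mat_delete_def tridiag_mat_def)
  have "det ?M = (\<Sum>i<Suc n. ?M $$ (i, n) * cofactor ?M i n)"
    by (rule laplace_expansion_column[OF M]) simp
  also have "\<dots> = u n * cofactor ?M n n"
    by (simp add: M_entry)
  also have "\<dots> = u n * det (?T n)"
    by (simp add: cofactor_def minor)
  finally have det_M: "det ?M = u n * det (?T n)" .
  have "det ?A = (\<Sum>j<Suc (Suc n). ?A $$ (Suc n, j) * cofactor ?A (Suc n) j)"
    by (rule laplace_expansion_row[OF A]) simp
  also have "\<dots> = l n * cofactor ?A (Suc n) n + d (Suc n) * cofactor ?A (Suc n) (Suc n)"
    by (simp add: tridiag_mat_def)
  also have "\<dots> = d (Suc n) * det (?T (Suc n)) - l n * u n * det (?T n)"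
    by (simp add: cofactor_def corner det_M)
  finally show ?thesis .
qed

lemma det_tridiag_mat_0: "det (tridiag_mat d u l 0) = 1"
  by (simp add: tridiag_mat_def)

lemma det_tridiag_mat_1: "det (tridiag_mat d u l (Suc 0)) = d 0"
  by (subst det_single) (simp_all add: tridiag_mat_def)

lemma pell_mat_eq_tridiag_mat:
  "pell_mat a k n = tridiag_mat (\<lambda>i. if i = 0 then a * k + 2 * a else 2)
     (\<lambda>i. if i = 0 then a * k else k) (\<lambda>_. - 1) n"
  by (rule eq_matI) (auto simp: pell_mat_def tridiag_mat_def)

text \<open>
  In its first step the continuant recurrence has \<open>a * k\<close> times the empty determinant 1, where the
  Pell recurrence has \<open>k\<close> times the term \<open>a\<close>. The products agree but the coefficients do not, so
  size 2 is a base case of its own; from size 3 on the two recurrences have the same coefficients.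
\<close>

lemma det_pell_mat: "det (pell_mat a k (Suc n)) = gen_pell a k (Suc (Suc n))"
proof (induction a k n rule: gen_pell.induct)
  case (1 a k)
  then show ?case
    by (simp add: pell_mat_eq_tridiag_mat det_tridiag_mat_1)
next
  case (2 a k)
  then show ?case
    by (simp add: pell_mat_eq_tridiag_mat det_tridiag_mat_Suc_Suc det_tridiag_mat_0
        det_tridiag_mat_1 algebra_simps)
next
  case (3 a k n)
  have "det (pell_mat a k (Suc (Suc (Suc n)))) =
      2 * det (pell_mat a k (Suc (Suc n))) + k * det (pell_mat a k (Suc n))"
    unfolding pell_mat_eq_tridiag_mat by (subst det_tridiag_mat_Suc_Suc) simp
  then show ?case
    by (simp only: 3 gen_pell.simps(3)[of a k "Suc (Suc n)"])
qed

theorem theorem3p4: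
  fixes a k :: int and n :: nat
  assumes "a > 0" and "k > 0" and "n > 0"
  shows "det (pell_mat a k n) = gen_pell a k (n + 1)"
  using det_pell_mat[of a k "n - 1"] assms(3) by simp

end
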